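(* Let $k$ be an algebraically closed field of characteristic zero, and let $H_n$ be the standard $n$-dimensional Heisenberg Lie algebra over $k$, $n=2m+1$, with basis $x_1,\dots,x_m,y_1,\dots,y_m,z$ and nonzero brackets $[x_i,y_i]=z$, $i=1,\dots,m$. Then $P=\langle y_1,\dots,y_m,z\rangle$ is a CP of $H_n$, and therefore $\alpha(H_n)=m+1$.
   Context: For a finite dimensional Lie algebra $L$ and $\xi\in L^*$ put $L(\xi)=\{x\in L : \xi([x,y])=0 \text{ for all } y\in L\}$; the index is $i(L)=\min_{\xi\in L^*}\dim L(\xi)$; the magic number is $c(L)=(\dim L+i(L))/2$ (an integer). $\alpha(L)$ denotes the maximum dimension of an abelian subalgebra of $L$. A CP (commutative polarization) of $L$ is a commutative subalgebra $P$ of $L$ with $\dim P=c(L)$. *)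

theory Defs
  imports "HOL-Analysis.Cartesian_Space" "HOL-Computational_Algebra.Polynomial"
begin

locale lie_algebra = vector_space scale
  for scale :: "'k::field \<Rightarrow> 'v::ab_group_add \<Rightarrow> 'v" (infixr "\<cdot>" 75) +
  fixes bracket :: "'v \<Rightarrow> 'v \<Rightarrow> 'v" ("\<lbrakk>_, _\<rbrakk>")
  assumes bracket_add_left: "\<lbrakk>u + v, w\<rbrakk> = \<lbrakk>u, w\<rbrakk> + \<lbrakk>v, w\<rbrakk>"
    and bracket_add_right: "\<lbrakk>u, v + w\<rbrakk> = \<lbrakk>u, v\<rbrakk> + \<lbrakk>u, w\<rbrakk>"
    and bracket_scale_left: "\<lbrakk>a \<cdot> u, v\<rbrakk> = a \<cdot> \<lbrakk>u, v\<rbrakk>"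
    and bracket_scale_right: "\<lbrakk>u, a \<cdot> v\<rbrakk> = a \<cdot> \<lbrakk>u, v\<rbrakk>"
    and bracket_self: "\<lbrakk>u, u\<rbrakk> = 0"
    and jacobi: "\<lbrakk>u, \<lbrakk>v, w\<rbrakk>\<rbrakk> + \<lbrakk>v, \<lbrakk>w, u\<rbrakk>\<rbrakk> + \<lbrakk>w, \<lbrakk>u, v\<rbrakk>\<rbrakk> = 0"
begin

definition subalgebra :: "'v set \<Rightarrow> bool" where
  "subalgebra A \<longleftrightarrow> subspace A \<and> (\<forall>u\<in>A. \<forall>v\<in>A. \<lbrakk>u, v\<rbrakk> \<in> A)"

definition commutative_subalgebra :: "'v set \<Rightarrow> bool" where
  "commutative_subalgebra A \<longleftrightarrow> subalgebra A \<and> (\<forall>u\<in>A. \<forall>v\<in>A. \<lbrakk>u, v\<rbrakk> = 0)"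

end

locale fd_lie_algebra = lie_algebra scale bracket
  for scale :: "'k::field \<Rightarrow> 'v::ab_group_add \<Rightarrow> 'v" (infixr "\<cdot>" 75)
    and bracket ("\<lbrakk>_, _\<rbrakk>") +
  assumes finite_dimensional: "\<exists>B. finite B \<and> span B = UNIV"
begin

definition dual :: "('v \<Rightarrow> 'k) set" where
  "dual = {\<xi>. Vector_Spaces.linear scale (*) \<xi>}"

definition stabilizer :: "('v \<Rightarrow> 'k) \<Rightarrow> 'v set" where
  "stabilizer \<xi> = {u. \<forall>v. \<xi> \<lbrakk>u, v\<rbrakk> = 0}"

definition index :: nat where
  "index = Min ((\<lambda>\<xi>. dim (stabilizer \<xi>)) ` dual)"

text \<open>The magic number \<open>c(L)\<close> is rational by definition, so that no integrality is built in
  (as it would be with \<open>div\<close> on \<^typ>\<open>nat\<close>).\<close>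

definition magic_number :: rat where
  "magic_number = (of_nat (dim UNIV) + of_nat index) / 2"

text \<open>\<open>\<alpha>(L)\<close>\<close>

definition max_commutative_dim :: nat where
  "max_commutative_dim = Max {dim A | A. commutative_subalgebra A}"

text \<open>Commutative polarizations (CPs)\<close>

definition commutative_polarization :: "'v set \<Rightarrow> bool" where
  "commutative_polarization P \<longleftrightarrow>
     commutative_subalgebra P \<and> of_nat (dim P) = magic_number"

end

text \<open>The algebra \<open>H\<^sub>n\<close> with \<open>n = 2 * m + 1\<close>, with its standard basis. Only the values of \<open>x\<close>
  and \<open>y\<close> on \<open>{1..m}\<close> matter; the cardinality condition says that the listed basis vectors
  are pairwise distinct. Brackets not listed follow by antisymmetry.\<close>

locale heisenberg_algebra = fd_lie_algebra scale bracket
  for scale :: "'k::field \<Rightarrow> 'v::ab_group_add \<Rightarrow> 'v" (infixr "\<cdot>" 75)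
    and bracket ("\<lbrakk>_, _\<rbrakk>") +
  fixes m :: nat and x y :: "nat \<Rightarrow> 'v" and z :: 'v
  assumes basis_independent: "independent (x ` {1..m} \<union> y ` {1..m} \<union> {z})"
    and basis_span: "span (x ` {1..m} \<union> y ` {1..m} \<union> {z}) = UNIV"
    and basis_card: "card (x ` {1..m} \<union> y ` {1..m} \<union> {z}) = 2 * m + 1"
    and bracket_x_y: "\<lbrakk>i \<in> {1..m}; j \<in> {1..m}\<rbrakk> \<Longrightarrow> \<lbrakk>x i, y j\<rbrakk> = (if i = j then z else 0)"
    and bracket_x_x: "\<lbrakk>i \<in> {1..m}; j \<in> {1..m}\<rbrakk> \<Longrightarrow> \<lbrakk>x i, x j\<rbrakk> = 0"
    and bracket_y_y: "\<lbrakk>i \<in> {1..m}; j \<in> {1..m}\<rbrakk> \<Longrightarrow> \<lbrakk>y i, y j\<rbrakk> = 0"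
    and bracket_x_z: "i \<in> {1..m} \<Longrightarrow> \<lbrakk>x i, z\<rbrakk> = 0"
    and bracket_y_z: "i \<in> {1..m} \<Longrightarrow> \<lbrakk>y i, z\<rbrakk> = 0"

text \<open>A model with \<open>m = CARD('m)\<close>.\<close>

lemma heisenberg_algebra_exists:
  "\<exists>br x y z. heisenberg_algebra
     ((*s) :: 'k::field \<Rightarrow> 'k ^ ('m::finite + 'm + unit) \<Rightarrow> _) br CARD('m) x y z"
proof -
  define br :: "'k ^ ('m + 'm + unit) \<Rightarrow> 'k ^ ('m + 'm + unit) \<Rightarrow> 'k ^ ('m + 'm + unit)" where
    "br u v = (\<chi> k. if k = Inr (Inr ()) then
       (\<Sum>i\<in>UNIV. u $ Inl i * v $ Inr (Inl i) - u $ Inr (Inl i) * v $ Inl i) else 0)" for u v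
  obtain f :: "nat \<Rightarrow> 'm" where f: "bij_betw f {1..CARD('m)} UNIV"
    using ex_bij_betw_nat_finite_1[of "UNIV :: 'm set"] by auto
  define x :: "nat \<Rightarrow> 'k ^ ('m + 'm + unit)" where "x i = axis (Inl (f i)) 1" for i
  define y :: "nat \<Rightarrow> 'k ^ ('m + 'm + unit)" where "y i = axis (Inr (Inl (f i))) 1" for i
  define z :: "'k ^ ('m + 'm + unit)" where "z = axis (Inr (Inr ())) 1"
  have im: "f ` {1..CARD('m)} = UNIV" and inj: "inj_on f {1..CARD('m)}"
    using f by (auto simp: bij_betw_def)
  have xs: "x ` {1..CARD('m)} = (\<lambda>k. axis (Inl k) 1) ` UNIV"
    by (subst im[symmetric]) (simp add: x_def image_image)
  have ys: "y ` {1..CARD('m)} = (\<lambda>k. axis (Inr (Inl k)) 1) ` UNIV"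
    by (subst im[symmetric]) (simp add: y_def image_image)
  have U: "(\<exists>i. k = Inl i) \<or> (\<exists>i. k = Inr (Inl i)) \<or> k = Inr (Inr ())" for k :: "'m + 'm + unit"
    by (metis (full_types) old.unit.exhaust sum.exhaust)
  have B: "x ` {1..CARD('m)} \<union> y ` {1..CARD('m)} \<union> {z} = cart_basis"
    unfolding xs ys z_def cart_basis_def by (auto simp: image_iff) (metis U)
  have ker: "(\<Sum>i\<in>UNIV. (if i = c then 1 else 0) * (if i = d then 1 else 0)) =
      (if c = d then 1 else (0::'k))" for c d :: 'm
  proof -
    have "(if i = c then 1 else 0) * (if i = d then 1 else 0) =
        (if i = c then if c = d then 1 else 0 else (0::'k))" for i by auto
    then show ?thesis by simp
  qed
  show ?thesis
  proof (rule exI[of _ br], rule exI[of _ x], rule exI[of _ y], rule exI[of _ z], unfold_locales)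
    show "br (u + v) w = br u w + br v w" for u v w
      by (simp add: br_def vec_eq_iff algebra_simps sum.distrib sum_subtractf)
    show "br u (v + w) = br u v + br u w" for u v w
      by (simp add: br_def vec_eq_iff algebra_simps sum.distrib sum_subtractf)
    show "br (a *s u) v = a *s br u v" for a u v
      by (simp add: br_def vec_eq_iff sum_distrib_left algebra_simps)
    show "br u (a *s v) = a *s br u v" for a u v
      by (simp add: br_def vec_eq_iff sum_distrib_left algebra_simps)
    show "br u u = 0" for u
      by (simp add: br_def vec_eq_iff)
    show "br u (br v w) + br v (br w u) + br w (br u v) = 0" for u v w
      by (simp add: br_def vec_eq_iff)
    show "\<exists>B. finite B \<and> vec.span B = (UNIV :: ('k ^ ('m + 'm + unit)) set)"
      by (intro exI[of _ cart_basis]) (simp add: finite_cart_basis)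
    show "vec.independent (x ` {1..CARD('m)} \<union> y ` {1..CARD('m)} \<union> {z})"
      unfolding B by (rule vec.independent_Basis)
    show "vec.span (x ` {1..CARD('m)} \<union> y ` {1..CARD('m)} \<union> {z}) = UNIV"
      unfolding B by (rule vec.span_Basis)
    show "card (x ` {1..CARD('m)} \<union> y ` {1..CARD('m)} \<union> {z}) = 2 * CARD('m) + 1"
      unfolding B by (simp add: card_cart_basis)
    show "br (x i) (y j) = (if i = j then z else 0)"
      if "i \<in> {1..CARD('m)}" "j \<in> {1..CARD('m)}" for i j
      using inj_on_eq_iff[OF inj that] 
      by (auto simp: br_def x_def y_def z_def vec_eq_iff axis_def ker)
    show "br (x i) (x j) = 0" "br (y i) (y j) = 0" "br (x i) z = 0" "br (y i) z = 0" for i j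
      by (auto simp: br_def x_def y_def z_def vec_eq_iff axis_def)
  qed
qed

end

theory Submission
  imports Defs
begin

text \<open>
  For a linear functional \<open>\<xi>\<close> on a Lie algebra \<open>L\<close>, the form \<open>(u, v) \<mapsto> \<xi> \<lbrakk>u, v\<rbrakk>\<close> is alternating
  with radical \<open>L(\<xi>)\<close>, and a commutative subalgebra \<open>A\<close> is isotropic for it.  The familiar bound
  \<open>2 dim A \<le> dim L + dim L(\<xi>)\<close> on isotropic subspaces (lemma \<open>commutative_dim_bound\<close>) therefore
  holds for every \<open>\<xi>\<close>; minimizing over \<open>\<xi>\<close> gives \<open>dim A \<le> c(L)\<close>.  Hence a commutative
  polarization, as soon as one exists, has the largest dimension possible for a commutative
  subalgebra: this is the ``therefore'' in the statement.

  For the Heisenberg algebra, \<open>P = \<langle>y\<^sub>1, \<dots>, y\<^sub>m, z\<rangle>\<close> is commutative of dimension \<open>m + 1\<close>, and it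
  remains to see that \<open>c(H\<^sub>n) = m + 1\<close>, that is, that the index is \<open>1\<close>.  The lower bound comes from
  \<open>P\<close> itself, by the inequality above: \<open>2 (m + 1) \<le> (2 m + 1) + dim L(\<xi>)\<close>.  For the upper
  bound, let \<open>\<xi>\<close> be the \<open>z\<close>-coordinate.  As \<open>\<lbrakk>u, y\<^sub>j\<rbrakk>\<close> and \<open>\<lbrakk>u, x\<^sub>j\<rbrakk>\<close> are, up to sign, \<open>z\<close> times the
  \<open>x\<^sub>j\<close>- and the \<open>y\<^sub>j\<close>-coordinate of \<open>u\<close>, an element of \<open>L(\<xi>)\<close> has only a \<open>z\<close>-coordinate.
\<close>

section \<open>Commutative subalgebras and the magic number\<close>

context finite_dimensional_vector_space
begin

lemma dim_le_dim_kernel_plus_1: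
  assumes S: "subspace S" and f: "Vector_Spaces.linear scale (*) f"
  shows "dim S \<le> dim {u \<in> S. f u = 0} + 1"
proof (cases "\<forall>u\<in>S. f u = 0")
  case True
  then have "{u \<in> S. f u = 0} = S" by blast
  then show ?thesis by simp
next
  case False
  then obtain v where v: "v \<in> S" "f v \<noteq> 0" by blast
  interpret f: Vector_Spaces.linear scale "(*)" f by (rule f)
  let ?K = "{u \<in> S. f u = 0}"
  have "S \<subseteq> span (insert v ?K)"
  proof
    fix u assume u: "u \<in> S"
    let ?a = "f u / f v"
    have "u - scale ?a v \<in> ?K"
      using S u v by (simp add: subspace_diff subspace_scale f.diff f.scale)
    then have "u - scale ?a v \<in> span ?K" by (rule span_base)
    then show "u \<in> span (insert v ?K)" unfolding span_insert by blast
  qed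
  then have "dim S \<le> dim (insert v ?K)" by (rule dim_mono)
  also have "\<dots> \<le> dim ?K + 1" by (simp add: dim_insert)
  finally show ?thesis .
qed

lemma dim_le_dim_common_kernel_plus_card:
  assumes "finite I" and S: "subspace S"
    and f: "\<And>i. i \<in> I \<Longrightarrow> Vector_Spaces.linear scale (*) (f i)"
  shows "dim S \<le> dim {u \<in> S. \<forall>i\<in>I. f i u = 0} + card I"
  using \<open>finite I\<close> f
proof (induction I)
  case empty
  then show ?case by simp
next
  case (insert j I)
  let ?K = "{u \<in> S. \<forall>i\<in>I. f i u = 0}"
  have K: "subspace ?K"
    unfolding subspace_def
  proof (intro conjI ballI allI)
    have lin: "f i 0 = 0" "f i (u + v) = f i u + f i v" "f i (scale c u) = c * f i u"
      if "i \<in> I" for i u v c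
    proof -
      interpret fi: Vector_Spaces.linear scale "(*)" "f i"
        using insert.prems that by blast
      show "f i 0 = 0" "f i (u + v) = f i u + f i v" "f i (scale c u) = c * f i u"
        by (simp_all add: fi.add fi.scale)
    qed
    show "0 \<in> ?K" using S lin by (simp add: subspace_0)
    show "u + v \<in> ?K" if "u \<in> ?K" "v \<in> ?K" for u v
      using S lin that by (simp add: subspace_add)
    show "scale c u \<in> ?K" if "u \<in> ?K" for u c
      using S lin that by (simp add: subspace_scale)
  qed
  have "dim S \<le> dim ?K + card I" using insert by blast
  also have "dim ?K \<le> dim {u \<in> ?K. f j u = 0} + 1"
    using K insert.prems by (intro dim_le_dim_kernel_plus_1) auto
  also have "{u \<in> ?K. f j u = 0} = {u \<in> S. \<forall>i\<in>insert j I. f i u = 0}" by blast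
  finally show ?case using insert.hyps by simp
qed

end

context lie_algebra
begin

lemma linear_bracket_left: "Vector_Spaces.linear scale scale (\<lambda>u. \<lbrakk>u, v\<rbrakk>)"
  by (simp add: Vector_Spaces.linear_iff vector_space_axioms bracket_add_left bracket_scale_left)

lemma linear_bracket_right: "Vector_Spaces.linear scale scale (\<lambda>v. \<lbrakk>u, v\<rbrakk>)"
  by (simp add: Vector_Spaces.linear_iff vector_space_axioms bracket_add_right bracket_scale_right)

lemma bracket_antisym: "\<lbrakk>u, v\<rbrakk> = - \<lbrakk>v, u\<rbrakk>"
proof -
  have "0 = \<lbrakk>u + v, u + v\<rbrakk>" by (simp only: bracket_self)
  also have "\<dots> = \<lbrakk>u, v\<rbrakk> + \<lbrakk>v, u\<rbrakk>"
    by (subst bracket_add_left, simp only: bracket_add_right bracket_self) simp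
  finally show ?thesis by (metis eq_neg_iff_add_eq_0)
qed

lemma commutative_subalgebra_span:
  assumes "\<And>u v. u \<in> S \<Longrightarrow> v \<in> S \<Longrightarrow> \<lbrakk>u, v\<rbrakk> = 0"
  shows "commutative_subalgebra (span S)"
proof -
  interpret vector_space_pair scale scale ..
  have "\<lbrakk>u, v\<rbrakk> = 0" if u: "u \<in> span S" and v: "v \<in> S" for u v
    using linear_eq_0_on_span[OF linear_bracket_left, of S v u] assms u v by blast
  then have "\<lbrakk>u, v\<rbrakk> = 0" if "u \<in> span S" "v \<in> span S" for u v
    using linear_eq_0_on_span[OF linear_bracket_right, of S u v] that by blast
  then show ?thesis
    by (simp add: commutative_subalgebra_def subalgebra_def span_zero)
qed

end

context fd_lie_algebra
begin

lemma finite_dimensional_vector_space_ex: "\<exists>B. finite_dimensional_vector_space scale B"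
proof -
  obtain C where C: "finite C" "span C = UNIV" using finite_dimensional by blast
  obtain B where "B \<subseteq> C" "independent B" "C \<subseteq> span B"
    using maximal_independent_subset by blast
  moreover from this have "span B = UNIV"
    using C(2) span_minimal[of C "span B"] by auto
  moreover have "finite B" using C(1) \<open>B \<subseteq> C\<close> by (rule rev_finite_subset)
  ultimately have "finite_dimensional_vector_space scale B"
    by unfold_locales
  then show ?thesis ..
qed

lemma dim_le_dim_UNIV: "dim S \<le> dim UNIV"
proof -
  obtain B where "finite_dimensional_vector_space scale B"
    using finite_dimensional_vector_space_ex ..
  then interpret fd: finite_dimensional_vector_space scale B .
  show ?thesis by (rule fd.dim_subset) simp
qed

text \<open>
  Choose a basis of a complement of \<open>A\<close>.  As the form \<open>\<xi> \<lbrakk>u, v\<rbrakk>\<close> already vanishes on \<open>A\<close>, an element of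
  \<open>A\<close> lies in the radical as soon as it is orthogonal to these \<open>dim L - dim A\<close> vectors.  So the
  radical contains the common kernel of that many functionals on \<open>A\<close>, whose dimension is at least
  \<open>dim A - (dim L - dim A)\<close>.
\<close>

lemma commutative_dim_bound:
  assumes A: "commutative_subalgebra A" and \<xi>: "\<xi> \<in> dual"
  shows "2 * dim A \<le> dim UNIV + dim (stabilizer \<xi>)"
proof -
  obtain B where "finite_dimensional_vector_space scale B"
    using finite_dimensional_vector_space_ex ..
  then interpret fd: finite_dimensional_vector_space scale B .
  interpret f: Vector_Spaces.linear scale "(*)" \<xi> using \<xi> by (simp add: dual_def)
  interpret vector_space_pair scale "(*) :: 'k \<Rightarrow> _" ..
  have subA: "subspace A" and zero: "\<And>u v. u \<in> A \<Longrightarrow> v \<in> A \<Longrightarrow> \<lbrakk>u, v\<rbrakk> = 0"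
    using A by (auto simp: commutative_subalgebra_def subalgebra_def)
  have lin_left: "Vector_Spaces.linear scale (*) (\<lambda>u. \<xi> \<lbrakk>u, v\<rbrakk>)" for v
    by (simp add: Vector_Spaces.linear_iff vector_space_axioms vector_space_over_itself.vector_space_axioms
        bracket_add_left bracket_scale_left f.add f.scale)
  have lin_right: "Vector_Spaces.linear scale (*) (\<lambda>v. \<xi> \<lbrakk>u, v\<rbrakk>)" for u
    by (simp add: Vector_Spaces.linear_iff vector_space_axioms vector_space_over_itself.vector_space_axioms
        bracket_add_right bracket_scale_right f.add f.scale)
  obtain C where C: "C \<subseteq> A" "independent C" "card C = dim A"
    using basis_exists[of A] by metis
  obtain D where D: "C \<subseteq> D" "independent D" "UNIV \<subseteq> span D"
    using maximal_independent_subset_extend[of C UNIV] C(2) by auto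
  have fin: "finite D" using D(2) by (rule fd.finiteI_independent)
  have cardD: "card D = dim UNIV"
    using D(2,3) basis_card_eq_dim[of D UNIV] by simp
  let ?R = "{u \<in> A. \<forall>v\<in>D - C. \<xi> \<lbrakk>u, v\<rbrakk> = 0}"
  have "?R \<subseteq> stabilizer \<xi>"
  proof
    fix u assume u: "u \<in> ?R"
    then have "\<xi> \<lbrakk>u, v\<rbrakk> = 0" if "v \<in> D" for v
      using zero[of u v] C(1) that f.zero by (cases "v \<in> C") auto
    then have "\<xi> \<lbrakk>u, v\<rbrakk> = 0" for v
      using linear_eq_0_on_span[OF lin_right, of D u v] D(3) by blast
    then show "u \<in> stabilizer \<xi>" by (simp add: stabilizer_def)
  qed
  then have "dim ?R \<le> dim (stabilizer \<xi>)" by (rule fd.dim_subset)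
  moreover have "dim A \<le> dim ?R + card (D - C)"
    using fin subA lin_left by (intro fd.dim_le_dim_common_kernel_plus_card) auto
  moreover have "card (D - C) + dim A = dim UNIV"
    using D(1) fin C(3) cardD card_mono[OF fin D(1)] by (simp add: card_Diff_subset finite_subset)
  ultimately show ?thesis by linarith
qed

lemma finite_stabilizer_dims: "finite ((\<lambda>\<xi>. dim (stabilizer \<xi>)) ` dual)"
  by (rule finite_subset[of _ "{..dim UNIV}"]) (auto simp: dim_le_dim_UNIV)

lemma index_le: "\<xi> \<in> dual \<Longrightarrow> index \<le> dim (stabilizer \<xi>)"
  unfolding index_def by (intro Min_le finite_stabilizer_dims imageI)

lemma index_attained: obtains \<xi> where "\<xi> \<in> dual" "index = dim (stabilizer \<xi>)"
proof -
  have "(\<lambda>u. 0) \<in> dual"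
    by (simp add: dual_def Vector_Spaces.linear_iff vector_space_axioms vector_space_over_itself.vector_space_axioms)
  then have "index \<in> (\<lambda>\<xi>. dim (stabilizer \<xi>)) ` dual"
    unfolding index_def by (intro Min_in finite_stabilizer_dims) blast
  then show ?thesis using that by blast
qed

lemma commutative_dim_le_index:
  assumes "commutative_subalgebra A"
  shows "2 * dim A \<le> dim UNIV + index"
  using index_attained commutative_dim_bound[OF assms] by metis

lemma commutative_dim_le_magic_number:
  assumes "commutative_subalgebra A"
  shows "of_nat (dim A) \<le> magic_number"
proof -
  have "(of_nat (2 * dim A) :: rat) \<le> of_nat (dim UNIV + index)"
    using commutative_dim_le_index[OF assms] by (simp only: of_nat_le_iff)
  then show ?thesis by (simp add: magic_number_def)
qed

lemma commutative_polarization_max: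
  assumes P: "commutative_polarization P"
  shows "max_commutative_dim = dim P"
  unfolding max_commutative_dim_def
proof (rule Max_eqI)
  show "finite {dim A |A. commutative_subalgebra A}"
    by (rule finite_subset[of _ "{..dim UNIV}"]) (auto simp: dim_le_dim_UNIV)
  show "dim P \<in> {dim A |A. commutative_subalgebra A}"
    using P by (auto simp: commutative_polarization_def)
  show "d \<le> dim P" if "d \<in> {dim A |A. commutative_subalgebra A}" for d
  proof -
    obtain A where d: "d = dim A" and A: "commutative_subalgebra A" using \<open>d \<in> _\<close> by blast
    have "(of_nat (dim A) :: rat) \<le> of_nat (dim P)"
      using commutative_dim_le_magic_number[OF A] P by (simp add: commutative_polarization_def)
    then show ?thesis using d by simp
  qed
qed

end

section \<open>The Heisenberg algebra\<close>

context heisenberg_algebra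
begin

abbreviation basis :: "'v set" where
  "basis \<equiv> x ` {1..m} \<union> y ` {1..m} \<union> {z}"

abbreviation coord :: "'v \<Rightarrow> 'v \<Rightarrow> 'k" where
  "coord \<equiv> representation basis"

text \<open>
  The cardinality \<open>2 m + 1\<close> is the maximum for a set listed by \<open>m + m + 1\<close> vectors, so it leaves
  no room for coincidences.
\<close>

lemma basis_distinct:
  shows inj_x: "inj_on x {1..m}" and inj_y: "inj_on y {1..m}"
    and x_ne_y: "\<lbrakk>i \<in> {1..m}; j \<in> {1..m}\<rbrakk> \<Longrightarrow> x i \<noteq> y j"
    and x_ne_z: "i \<in> {1..m} \<Longrightarrow> x i \<noteq> z" and y_ne_z: "i \<in> {1..m} \<Longrightarrow> y i \<noteq> z"
proof -
  let ?X = "x ` {1..m}" and ?Y = "y ` {1..m}"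
  have X: "card ?X \<le> m" and Y: "card ?Y \<le> m"
    using card_image_le[of "{1..m}"] by (metis finite_atLeastAtMost card_atLeastAtMost diff_Suc_1)+
  have XY: "card ?X + card ?Y = card (?X \<union> ?Y) + card (?X \<inter> ?Y)"
    by (rule card_Un_Int) auto
  have XYZ: "card (?X \<union> ?Y) + 1 = 2 * m + 1 + card ((?X \<union> ?Y) \<inter> {z})"
    using card_Un_Int[of "?X \<union> ?Y" "{z}"] basis_card by simp
  have eqs: "card ?X = m" "card ?Y = m" "card (?X \<inter> ?Y) = 0" "card ((?X \<union> ?Y) \<inter> {z}) = 0"
    using X Y XY XYZ by linarith+
  show "inj_on x {1..m}" "inj_on y {1..m}"
    using eqs(1,2) by (auto intro!: eq_card_imp_inj_on)
  show "x i \<noteq> y j" if "i \<in> {1..m}" "j \<in> {1..m}" for i j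
    proof -
    have "?X \<inter> ?Y = {}" using eqs(3) by (simp add: card_eq_0_iff)
    then show ?thesis using that by blast
  qed
  have "z \<notin> ?X \<union> ?Y" using eqs(4) by (auto simp: card_eq_0_iff)
  then show "x i \<noteq> z" "y i \<noteq> z" if "i \<in> {1..m}" for i using that by blast+
qed

lemma dim_UNIV_heisenberg: "dim UNIV = 2 * m + 1"
  using basis_card_eq_dim[of basis UNIV] basis_independent basis_span basis_card by simp

lemma dim_span_y_z: "dim (span (y ` {1..m} \<union> {z})) = m + 1"
proof -
  have "independent (y ` {1..m} \<union> {z})"
    by (rule independent_mono[OF basis_independent]) blast
  then have "dim (span (y ` {1..m} \<union> {z})) = card (y ` {1..m} \<union> {z})"
    by (rule dim_span_eq_card_independent)
  also have "\<dots> = card (insert z (y ` {1..m}))" by simp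
  also have "\<dots> = Suc (card (y ` {1..m}))"
    by (rule card_insert_disjoint) (use y_ne_z in force)+
  also have "\<dots> = m + 1" using card_image[OF inj_y] by simp
  finally show ?thesis .
qed

lemma commutative_span_y_z: "commutative_subalgebra (span (y ` {1..m} \<union> {z}))"
proof (rule commutative_subalgebra_span)
  have "\<lbrakk>z, y i\<rbrakk> = 0" if "i \<in> {1..m}" for i
    using bracket_antisym[of z "y i"] bracket_y_z that by simp
  then show "\<lbrakk>u, v\<rbrakk> = 0" if "u \<in> y ` {1..m} \<union> {z}" "v \<in> y ` {1..m} \<union> {z}" for u v
    using that bracket_y_y bracket_y_z bracket_self by auto
qed

lemma coord_basis: "b \<in> basis \<Longrightarrow> coord b c = (if c = b then 1 else 0)"
  using representation_basis[OF basis_independent] by presburger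

lemma linear_coord: "Vector_Spaces.linear scale (*) (\<lambda>u. coord u b)"
  by (rule linear_representation[OF basis_independent basis_span])

lemma linear_coord_scale: "Vector_Spaces.linear scale scale (\<lambda>u. coord u b \<cdot> c)"
  using basis_independent basis_span
  by (simp add: Vector_Spaces.linear_iff vector_space_axioms representation_add
      representation_scale scale_left_distrib)

lemma linear_eqI_basis:
  assumes "Vector_Spaces.linear scale scale f" "Vector_Spaces.linear scale scale g"
    and "\<And>b. b \<in> basis \<Longrightarrow> f b = g b"
  shows "f u = g u"
proof -
  interpret vector_space_pair scale scale ..
  show ?thesis using linear_eq_on[OF assms(1,2), of u basis] assms(3) basis_span by blast
qed

lemma bracket_y:
  assumes j: "j \<in> {1..m}"
  shows "\<lbrakk>u, y j\<rbrakk> = coord u (x j) \<cdot> z"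
proof (rule linear_eqI_basis[OF linear_bracket_left linear_coord_scale])
  fix b assume b: "b \<in> basis"
  have zy: "\<lbrakk>z, y j\<rbrakk> = 0" using bracket_antisym[of z "y j"] bracket_y_z[OF j] by simp
  consider i where "i \<in> {1..m}" "b = x i" | i where "i \<in> {1..m}" "b = y i" | "b = z"
    using b by blast
  then show "\<lbrakk>b, y j\<rbrakk> = coord b (x j) \<cdot> z"
  proof cases
    case 1
    then show ?thesis
      using b j by (simp only: coord_basis bracket_x_y) (auto simp: inj_on_eq_iff[OF inj_x])
  next
    case 2
    then show ?thesis using b j x_ne_y[OF j] by (simp only: coord_basis bracket_y_y) simp
  next
    case 3
    then show ?thesis using b x_ne_z[OF j] zy by (simp only: coord_basis) simp
  qed
qed

lemma bracket_x:
  assumes j: "j \<in> {1..m}"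
  shows "\<lbrakk>x j, u\<rbrakk> = coord u (y j) \<cdot> z"
proof (rule linear_eqI_basis[OF linear_bracket_right linear_coord_scale])
  fix b assume b: "b \<in> basis"
  consider i where "i \<in> {1..m}" "b = x i" | i where "i \<in> {1..m}" "b = y i" | "b = z"
    using b by blast
  then show "\<lbrakk>x j, b\<rbrakk> = coord b (y j) \<cdot> z"
  proof cases
    case 1
    then show ?thesis using b j x_ne_y[OF 1(1) j] by (simp only: coord_basis bracket_x_x) auto
  next
    case 2
    then show ?thesis
      using b j by (simp only: coord_basis bracket_x_y) (auto simp: inj_on_eq_iff[OF inj_y])
  next
    case 3
    then show ?thesis
      using b y_ne_z[OF j] bracket_x_z[OF j] by (simp only: coord_basis) simp
  qed
qed

lemma stabilizer_coord_z: "stabilizer (\<lambda>u. coord u z) \<subseteq> span {z}"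
proof
  fix u assume "u \<in> stabilizer (\<lambda>u. coord u z)"
  then have u: "coord \<lbrakk>u, v\<rbrakk> z = 0" for v by (simp add: stabilizer_def)
  have coord_z: "coord (a \<cdot> z) z = a" for a
  proof -
    have "coord (a \<cdot> z) z = a * coord z z"
      using representation_scale[OF basis_independent, of z a] basis_span by simp
    also have "coord z z = 1" by (subst coord_basis) auto
    finally show ?thesis by simp
  qed
  have "coord u (x j) = 0" if "j \<in> {1..m}" for j
    using u[of "y j"] by (simp only: bracket_y[OF that] coord_z)
  moreover have "coord u (y j) = 0" if j: "j \<in> {1..m}" for j
  proof -
    have "\<lbrakk>u, x j\<rbrakk> = (- coord u (y j)) \<cdot> z"
      using bracket_antisym[of u "x j"] bracket_x[OF j] by simp
    then show ?thesis using u[of "x j"] by (simp only: coord_z) simp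
  qed
  ultimately have supp: "{b. coord u b \<noteq> 0} \<subseteq> {z}"
    using representation_ne_zero[of basis u] by blast
  have "u = (\<Sum>b | coord u b \<noteq> 0. coord u b \<cdot> b)"
    using sum_nonzero_representation_eq[OF basis_independent, of u] basis_span by simp
  also have "\<dots> \<in> span {z}"
    using supp by (intro span_sum span_scale span_base) blast
  finally show "u \<in> span {z}" .
qed

lemma index_heisenberg: "index = 1"
proof (rule antisym)
  have "(\<lambda>u. coord u z) \<in> dual" unfolding dual_def using linear_coord by blast
  then have "index \<le> dim (stabilizer (\<lambda>u. coord u z))" by (rule index_le)
  also have "\<dots> \<le> card {z}" by (rule dim_le_card[OF stabilizer_coord_z]) simp
  finally show "index \<le> 1" by simp
  have "2 * (m + 1) \<le> 2 * m + 1 + index"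
    using commutative_dim_le_index[OF commutative_span_y_z]
    by (simp only: dim_span_y_z dim_UNIV_heisenberg)
  then show "1 \<le> index" by simp
qed

lemma commutative_polarization_span_y_z:
  "commutative_polarization (span (y ` {1..m} \<union> {z}))"
  unfolding commutative_polarization_def magic_number_def dim_span_y_z dim_UNIV_heisenberg
    index_heisenberg
  using commutative_span_y_z by simp

end

theorem proposition6p7:
  fixes scale :: "'k::{alg_closed_field, field_char_0} \<Rightarrow> 'v::ab_group_add \<Rightarrow> 'v"
    and bracket :: "'v \<Rightarrow> 'v \<Rightarrow> 'v"
    and m :: nat and x y :: "nat \<Rightarrow> 'v" and z :: 'v
  assumes "heisenberg_algebra scale bracket m x y z"
  shows "fd_lie_algebra.commutative_polarization scale bracket
           (module.span scale (y ` {1..m} \<union> {z}))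
         \<and> fd_lie_algebra.max_commutative_dim scale bracket = m + 1"
proof -
  interpret heisenberg_algebra scale bracket m x y z by (rule assms)
  show ?thesis
    using commutative_polarization_span_y_z
      commutative_polarization_max[OF commutative_polarization_span_y_z]
    by (simp only: dim_span_y_z)
qed

end
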